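(* Let $k\ge2$ and $m_1\ge m_2\ge \dots \ge m_k\ge1$ be integers, and let $K_{m_1,m_2,\dots,m_k}$ be the complete $k$-partite graph with parts of sizes $m_1,\dots,m_k$. (1) If $m_1=m_2$, then $\mathrm{QEC}(K_{m_1,m_2,\dots,m_k})=-2+m_1$. (2) If $m_1>m_2$, then $\mathrm{QEC}(K_{m_1,m_2,\dots,m_k})=-2-\alpha^*$, where $\alpha^*$ is the minimal real solution of the equation $\sum_{i=1}^k \frac{m_i}{\alpha+m_i}=0$. Moreover, $-m_1<\alpha^*<-m_2$.
   Context: Graphs are finite, simple and connected. For a graph $G=(V,E)$ with $|V|\ge2$, $d(x,y)$ denotes the graph distance (length of a shortest path) and $D=[d(x,y)]_{x,y\in V}$ the distance matrix. Functions $f:V\to\mathbb{R}$ are identified with column vectors, $\langle\cdot,\cdot\rangle$ is the canonical inner product and $\mathbf{1}$ is the all-ones vector. The quadratic embedding constant is $\mathrm{QEC}(G)=\max\{\langle f,Df\rangle : \langle f,f\rangle=1,\ \langle \mathbf{1},f\rangle=0\}$. The complete $k$-partite graph $K_{m_1,\dots,m_k}$ has vertex set the disjoint union of sets $V_1,\dots,V_k$ with $|V_i|=m_i$, two vertices being adjacent iff they lie in different parts. *)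

theory Defs
  imports Complex_Main "HOL-Library.Disjoint_Sets" "Graph_Theory.Digraph" "Graph_Theory.Shortest_Path"
begin

text \<open>
  A finite simple graph is a symmetric digraph satisfying the locale predicate
  \<^locale>\<open>graph\<close> of the library. With unit weights the cost of a walk is its length, so the
  library's shortest-path cost is the graph distance; it is finite on connected graphs.
\<close>

definition graph_dist :: "('a, 'b) pre_digraph \<Rightarrow> 'a \<Rightarrow> 'a \<Rightarrow> real" where
  "graph_dist G x y = real_of_ereal (wf_digraph.\<mu> G (\<lambda>_. 1) x y)"

lemma graph_dist_eq_length_shortest_walk:
  assumes "wf_digraph G" "reachable G x y"
  shows "graph_dist G x y = real (LEAST n. \<exists>p. pre_digraph.awalk G x p y \<and> length p = n)"
proof -
  interpret wf_digraph G by fact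
  have ac: "awalk_cost (\<lambda>_. 1) p = real (length p)" for p
    by (induct p) auto
  let ?P = "\<lambda>n. \<exists>p. awalk x p y \<and> length p = n"
  have ex: "\<exists>n. ?P n" using assms reachable_awalk by auto
  have "\<mu> (\<lambda>_. 1) x y = ereal (real (Least ?P))"
    unfolding \<mu>_def ac
  proof (rule antisym)
    obtain p where "awalk x p y" "length p = Least ?P" using LeastI_ex[OF ex] by auto
    then show "(INF p\<in>{p. awalk x p y}. ereal (real (length p))) \<le> ereal (real (Least ?P))"
      by (metis (mono_tags, lifting) INF_lower mem_Collect_eq)
    show "ereal (real (Least ?P)) \<le> (INF p\<in>{p. awalk x p y}. ereal (real (length p)))"
      by (rule INF_greatest) (auto intro!: Least_le)
  qed
  then show ?thesis unfolding graph_dist_def by simp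
qed

text \<open>
  Functions on the vertex set are represented by total functions whose values outside
  the vertex set are ignored.
\<close>

definition vinner :: "'a set \<Rightarrow> ('a \<Rightarrow> real) \<Rightarrow> ('a \<Rightarrow> real) \<Rightarrow> real" where
  "vinner V f g = (\<Sum>x\<in>V. f x * g x)"

definition dist_apply :: "('a, 'b) pre_digraph \<Rightarrow> ('a \<Rightarrow> real) \<Rightarrow> 'a \<Rightarrow> real" where
  "dist_apply G f x = (\<Sum>y\<in>verts G. graph_dist G x y * f y)"

text \<open>
  \<^term>\<open>Greatest\<close> is the maximum of a possibly infinite set; unlike a supremum it
  is specified only if the maximum is attained.
\<close>

definition QEC :: "('a, 'b) pre_digraph \<Rightarrow> real" where
  "QEC G = (GREATEST q. \<exists>f. vinner (verts G) f f = 1 \<and> vinner (verts G) (\<lambda>_. 1) f = 0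
                          \<and> q = vinner (verts G) f (dist_apply G f))"

definition complete_multipartite :: "nat \<Rightarrow> (nat \<Rightarrow> nat) \<Rightarrow> ('a, 'b) pre_digraph \<Rightarrow> bool" where
  "complete_multipartite k m G \<longleftrightarrow> graph G \<and>
     (\<exists>V. verts G = (\<Union>i\<in>{1..k}. V i) \<and> disjoint_family_on V {1..k} \<and>
          (\<forall>i\<in>{1..k}. finite (V i) \<and> card (V i) = m i) \<and>
          arcs_ends G = {(x, y). \<exists>i\<in>{1..k}. \<exists>j\<in>{1..k}. i \<noteq> j \<and> x \<in> V i \<and> y \<in> V j})"

text \<open>
  Poles are excluded explicitly, since division by zero yields zero in HOL.
\<close>

definition char_root :: "nat \<Rightarrow> (nat \<Rightarrow> nat) \<Rightarrow> real \<Rightarrow> bool" where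
  "char_root k m \<alpha> \<longleftrightarrow> (\<forall>i\<in>{1..k}. \<alpha> + real (m i) \<noteq> 0) \<and>
     (\<Sum>i=1..k. real (m i) / (\<alpha> + real (m i))) = 0"

end

theory Submission
  imports Defs "HOL-Analysis.Convex"
begin

text \<open>
  On zero-sum functions the quadratic form of the distance matrix is the sum of the squared part
  sums minus twice the squared norm. By Cauchy-Schwarz it is maximized by functions constant on
  the parts, so the constant is \<open>t - 2\<close> for the least \<open>t\<close> such that
  \<open>\<Sum>S\<^sub>i\<^sup>2 \<le> t \<Sum>S\<^sub>i\<^sup>2 / m\<^sub>i\<close> whenever \<open>\<Sum>S\<^sub>i = 0\<close>. If the two largest
  parts have equal size, \<open>t = m\<^sub>1\<close> is attained at opposite values on them. Otherwise
  \<open>t = - \<alpha>\<close> for the root \<open>\<alpha>\<close> of the characteristic equation in \<open>(- m\<^sub>1, - m\<^sub>2)\<close>, where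
  its left-hand side is strictly decreasing; to the left of \<open>- m\<^sub>1\<close> that side is negative.
\<close>

section \<open>Graph distances 0, 1 and 2 from explicit walks\<close>

context wf_digraph
begin

lemma graph_dist_eqI:
  assumes "awalk x p y" and "\<And>q. awalk x q y \<Longrightarrow> length p \<le> length q"
  shows "graph_dist G x y = real (length p)"
proof -
  have "(LEAST n. \<exists>q. awalk x q y \<and> length q = n) = length p"
    using assms by (intro Least_equality) auto
  moreover have "x \<rightarrow>\<^sup>* y" using assms(1) by (rule reachable_awalkI)
  ultimately show ?thesis
    using graph_dist_eq_length_shortest_walk[OF wf_digraph_axioms] by simp
qed

lemma graph_dist_self: "x \<in> verts G \<Longrightarrow> graph_dist G x x = 0"
  using graph_dist_eqI[of x "[]" x] by (simp add: awalk_Nil_iff)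

lemma awalk_singleton_of_arc:
  assumes "(x, y) \<in> arcs_ends G"
  obtains e where "awalk x [e] y"
  using assms by (auto simp: arcs_ends_def arc_to_ends_def intro: arc_implies_awalk)

lemma graph_dist_adjacent:
  assumes "(x, y) \<in> arcs_ends G" "x \<noteq> y"
  shows "graph_dist G x y = 1"
proof -
  obtain e where "awalk x [e] y" using awalk_singleton_of_arc[OF assms(1)] .
  moreover have "length [e] \<le> length q" if "awalk x q y" for q
    using that assms(2) by (cases q) (auto simp: awalk_Nil_iff)
  ultimately show ?thesis using graph_dist_eqI[of x "[e]" y] by simp
qed

text \<open>The walk through \<open>z\<close> has length 2; a shorter one would be empty, forcing
  \<open>x = y\<close>, or a single arc from \<open>x\<close> to \<open>y\<close>.\<close>

lemma graph_dist_common_neighbour: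
  assumes "(x, z) \<in> arcs_ends G" "(z, y) \<in> arcs_ends G" "(x, y) \<notin> arcs_ends G" "x \<noteq> y"
  shows "graph_dist G x y = 2"
proof -
  obtain e where e: "awalk x [e] z" using awalk_singleton_of_arc[OF assms(1)] .
  obtain e' where e': "awalk z [e'] y" using awalk_singleton_of_arc[OF assms(2)] .
  have "awalk x [e, e'] y" using awalk_appendI[OF e e'] by simp
  moreover have "length [e, e'] \<le> length q" if q: "awalk x q y" for q
  proof (rule ccontr)
    assume "\<not> length [e, e'] \<le> length q"
    then consider "q = []" | a where "q = [a]" by (cases q; cases "tl q") auto
    then show False
    proof cases
      case 1 then show False using q assms(4) by (simp add: awalk_Nil_iff)
    next
      case 2
      then have "a \<in> arcs G" "arc_to_ends G a = (x, y)"
        using q by (auto simp: awalk_Cons_iff awalk_Nil_iff arc_to_ends_def)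
      then show False using assms(3) by (force simp: arcs_ends_def)
    qed
  qed
  ultimately show ?thesis using graph_dist_eqI[of x "[e, e']" y] by simp
qed

end

section \<open>Complete multipartite graphs: distances, quadratic form and its maximum\<close>

lemma sum_disjoint_family:
  assumes "finite I" "disjoint_family_on V I" "\<And>i. i \<in> I \<Longrightarrow> finite (V i)"
  shows "sum f (\<Union>i\<in>I. V i) = (\<Sum>i\<in>I. sum f (V i))"
  using assms by (intro sum.UNION_disjoint) (auto simp: disjoint_family_on_def)

locale multipartite =
  fixes G :: "('a, 'b) pre_digraph" and k :: nat and m :: "nat \<Rightarrow> nat" and V :: "nat \<Rightarrow> 'a set"
  assumes graph: "graph G"
    and two_le: "k \<ge> 2"
    and parts: "verts G = (\<Union>i\<in>{1..k}. V i)"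
    and disjoint: "disjoint_family_on V {1..k}"
    and finite_part: "i \<in> {1..k} \<Longrightarrow> finite (V i)"
    and card_part: "i \<in> {1..k} \<Longrightarrow> card (V i) = m i"
    and part_pos: "i \<in> {1..k} \<Longrightarrow> m i > 0"
    and arcs: "arcs_ends G = {(x, y). \<exists>i\<in>{1..k}. \<exists>j\<in>{1..k}. i \<noteq> j \<and> x \<in> V i \<and> y \<in> V j}"
begin

sublocale graph G by (fact graph)

lemma part_unique:
  assumes "x \<in> V i" "x \<in> V j" "i \<in> {1..k}" "j \<in> {1..k}"
  shows "i = j"
  using assms disjoint unfolding disjoint_family_on_def by blast

lemma sum_verts: "sum f (verts G) = (\<Sum>i=1..k. sum f (V i))"
  unfolding parts by (intro sum_disjoint_family finite_part disjoint) auto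

lemma arc_parts_iff:
  assumes "x \<in> V i" "i \<in> {1..k}" "y \<in> V j" "j \<in> {1..k}"
  shows "(x, y) \<in> arcs_ends G \<longleftrightarrow> i \<noteq> j"
proof
  assume "(x, y) \<in> arcs_ends G"
  then show "i \<noteq> j" using assms part_unique unfolding arcs mem_Collect_eq prod.case by metis
next
  assume "i \<noteq> j"
  then show "(x, y) \<in> arcs_ends G"
    using assms unfolding arcs mem_Collect_eq prod.case by metis
qed

text \<open>Distinct vertices of one part are not adjacent, but every vertex of another part is a
  common neighbour. The closed form writes the distance matrix as \<open>J + B - 2 I\<close>, with
  \<open>J\<close> all ones and \<open>B\<close> the indicator of lying in the same part.\<close>

lemma graph_dist_parts:
  assumes x: "x \<in> V i" "i \<in> {1..k}" and y: "y \<in> V j" "j \<in> {1..k}"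
  shows "graph_dist G x y = 1 + of_bool (i = j) - 2 * of_bool (x = y)"
proof (cases "x = y")
  case True
  then have "i = j" "x \<in> verts G" using assms part_unique parts by auto
  then show ?thesis using True graph_dist_self by simp
next
  case False
  show ?thesis
  proof (cases "i = j")
    case True
    \<comment> \<open>Index of some part other than \<open>i\<close>; one of 1 and 2 always
      serves.\<close>
    define l :: nat where "l = (if i = 1 then 2 else 1)"
    have l: "l \<in> {1..k}" "l \<noteq> i" using two_le by (auto simp: l_def)
    obtain z where z: "z \<in> V l" using card_part[OF l(1)] part_pos[OF l(1)] by fastforce
    have "(x, z) \<in> arcs_ends G" "(z, y) \<in> arcs_ends G" "(x, y) \<notin> arcs_ends G"
      using arc_parts_iff x y z l True by metis+
    then show ?thesis
      using graph_dist_common_neighbour \<open>x \<noteq> y\<close> True by simp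
  next
    case False
    then have "(x, y) \<in> arcs_ends G" using arc_parts_iff x y by metis
    then show ?thesis using graph_dist_adjacent \<open>x \<noteq> y\<close> False by simp
  qed
qed

lemma dist_apply_parts:
  assumes x: "x \<in> V i" "i \<in> {1..k}"
  shows "dist_apply G f x = sum f (verts G) + sum f (V i) - 2 * f x"
proof -
  have part: "(\<Sum>y\<in>V j. graph_dist G x y * f y)
      = sum f (V j) + of_bool (i = j) * (sum f (V j) - 2 * f x)" if j: "j \<in> {1..k}" for j
  proof -
    have "(\<Sum>y\<in>V j. graph_dist G x y * f y)
        = (\<Sum>y\<in>V j. f y + of_bool (i = j) * f y - 2 * (if x = y then f y else 0))"
      using x j by (intro sum.cong) (auto simp: graph_dist_parts algebra_simps)
    also have "\<dots> = sum f (V j) + of_bool (i = j) * sum f (V j)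
        - 2 * (\<Sum>y\<in>V j. if x = y then f y else 0)"
      by (simp add: sum.distrib sum_subtractf sum_distrib_left)
    \<comment> \<open>Since the parts are disjoint, \<open>x\<close> occurs in \<open>V j\<close>
      only for \<open>j = i\<close>.\<close>
    also have "(\<Sum>y\<in>V j. if x = y then f y else 0) = of_bool (i = j) * f x"
      using x j finite_part[OF j] part_unique by (auto simp: sum.delta')
    finally show ?thesis by (simp add: algebra_simps)
  qed
  have "dist_apply G f x = (\<Sum>j=1..k. sum f (V j) + of_bool (i = j) * (sum f (V j) - 2 * f x))"
    unfolding dist_apply_def sum_verts by (intro sum.cong refl part)
  also have "\<dots> = sum f (verts G) + (\<Sum>j=1..k. if i = j then sum f (V j) - 2 * f x else 0)"
    unfolding sum_verts by (subst sum.distrib) (auto intro!: sum.cong)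
  finally show ?thesis using x by (simp add: sum.delta')
qed

text \<open>In \<open>J + B - 2 I\<close> the term \<open>J\<close> vanishes on zero-sum functions,
  and \<open>B\<close> contributes the squared part sums.\<close>

lemma quadratic_form_parts:
  assumes "sum f (verts G) = 0"
  shows "vinner (verts G) f (dist_apply G f)
    = (\<Sum>i=1..k. (sum f (V i))\<^sup>2) - 2 * vinner (verts G) f f"
proof -
  have "(\<Sum>x\<in>V i. f x * dist_apply G f x) = (sum f (V i))\<^sup>2 - 2 * (\<Sum>x\<in>V i. f x * f x)"
    if "i \<in> {1..k}" for i
  proof -
    have "(\<Sum>x\<in>V i. f x * dist_apply G f x) = (\<Sum>x\<in>V i. f x * sum f (V i) - 2 * (f x * f x))"
      using that assms by (intro sum.cong refl) (simp add: dist_apply_parts algebra_simps)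
    then show ?thesis
      by (simp add: sum_subtractf power2_eq_square flip: sum_distrib_left sum_distrib_right)
  qed
  then show ?thesis
    unfolding vinner_def sum_verts by (simp add: sum_subtractf sum_distrib_left)
qed

text \<open>\<open>Greatest\<close> needs an attained maximum. Besides the bound for zero-sum part
  sums \<open>S\<close>, a vector \<open>c\<close> of values on the parts is therefore supplied
  whose part sums \<open>S i = m i * c i\<close> turn the bound into an equality, as then
  \<open>(S i)\<^sup>2 / m i = m i * (c i)\<^sup>2\<close>.\<close>

lemma QEC_eqI:
  fixes c :: "nat \<Rightarrow> real"
  assumes bound: "\<And>S :: nat \<Rightarrow> real. (\<Sum>i=1..k. S i) = 0 \<Longrightarrow>
      (\<Sum>i=1..k. (S i)\<^sup>2) \<le> t * (\<Sum>i=1..k. (S i)\<^sup>2 / real (m i))"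
    and t: "t \<ge> 0"
    and c_sum: "(\<Sum>i=1..k. m i * c i) = 0"
    and c_eq: "(\<Sum>i=1..k. (m i * c i)\<^sup>2) = t * (\<Sum>i=1..k. m i * (c i)\<^sup>2)"
    and c_pos: "(\<Sum>i=1..k. m i * (c i)\<^sup>2) > 0"
  shows "QEC G = t - 2"
  unfolding QEC_def
proof (rule Greatest_equality)
  define N where "N = (\<Sum>i=1..k. m i * (c i)\<^sup>2)"
  \<comment> \<open>The vector \<open>c\<close> spread over the vertices and scaled to norm
    1.\<close>
  define f where "f x = c (THE i. i \<in> {1..k} \<and> x \<in> V i) / sqrt N" for x
  have f: "f x = c i / sqrt N" if "x \<in> V i" "i \<in> {1..k}" for x i
  proof -
    have "(THE i. i \<in> {1..k} \<and> x \<in> V i) = i" using that part_unique by blast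
    then show ?thesis by (simp add: f_def)
  qed
  have N: "N > 0" "sqrt N * sqrt N = N" using c_pos by (auto simp: N_def)
  have fsum: "sum f (V i) = m i * c i / sqrt N" if "i \<in> {1..k}" for i
    using that card_part by (simp add: f)
  have "sum f (verts G) = (\<Sum>i=1..k. m i * c i) / sqrt N"
    unfolding sum_verts by (simp add: fsum sum_divide_distrib)
  then have f0: "sum f (verts G) = 0" using c_sum by simp
  have "vinner (verts G) f f = (\<Sum>i=1..k. m i * (c i)\<^sup>2 / N)"
    unfolding vinner_def sum_verts using card_part N by (simp add: f power2_eq_square)
  also have "\<dots> = N / N" by (simp only: N_def sum_divide_distrib)
  finally have f1: "vinner (verts G) f f = 1" using N by simp
  have "(\<Sum>i=1..k. (sum f (V i))\<^sup>2) = (\<Sum>i=1..k. (m i * c i)\<^sup>2) / N"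
    using N by (simp add: fsum sum_divide_distrib power_divide)
  also have "\<dots> = t" using c_eq N by (simp add: N_def)
  finally have "t - 2 = vinner (verts G) f (dist_apply G f)"
    using quadratic_form_parts[OF f0] f1 by simp
  then show "\<exists>f. vinner (verts G) f f = 1 \<and> vinner (verts G) (\<lambda>_. 1) f = 0
      \<and> t - 2 = vinner (verts G) f (dist_apply G f)"
    using f0 f1 by (auto simp: vinner_def)
next
  fix q
  assume "\<exists>f. vinner (verts G) f f = 1 \<and> vinner (verts G) (\<lambda>_. 1) f = 0
      \<and> q = vinner (verts G) f (dist_apply G f)"
  then obtain f where f1: "vinner (verts G) f f = 1" and f0: "sum f (verts G) = 0"
    and q: "q = vinner (verts G) f (dist_apply G f)"
    by (auto simp: vinner_def)
  have "(\<Sum>i=1..k. (sum f (V i))\<^sup>2 / m i) \<le> (\<Sum>i=1..k. \<Sum>x\<in>V i. f x * f x)"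
  proof (rule sum_mono)
    fix i assume i: "i \<in> {1..k}"
    \<comment> \<open>Cauchy-Schwarz against the constant 1, whose squared norm on the part is its
      size.\<close>
    have "(sum f (V i))\<^sup>2 \<le> m i * (\<Sum>x\<in>V i. f x * f x)"
      using Cauchy_Schwarz_ineq_sum[of "\<lambda>_. 1" f "V i"] card_part[OF i]
      by (simp add: power2_eq_square)
    then show "(sum f (V i))\<^sup>2 / m i \<le> (\<Sum>x\<in>V i. f x * f x)"
      using part_pos[OF i] by (simp add: field_simps)
  qed
  also have "\<dots> = 1" using f1 by (simp add: vinner_def sum_verts)
  finally have "t * (\<Sum>i=1..k. (sum f (V i))\<^sup>2 / m i) \<le> t"
    using t by (simp add: mult_left_le)
  moreover have "(\<Sum>i=1..k. sum f (V i)) = 0" using f0 by (simp only: sum_verts)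
  ultimately show "q \<le> t - 2"
    using bound[of "\<lambda>i. sum f (V i)"] quadratic_form_parts[OF f0] f1 q by simp
qed

end

section \<open>A sharp inequality for zero-sum vectors\<close>

lemma sum_atLeast1_split:
  fixes g :: "nat \<Rightarrow> 'a::comm_monoid_add"
  assumes "k \<ge> 1"
  shows "(\<Sum>i=1..k. g i) = g 1 + (\<Sum>i=2..k. g i)"
  using sum.atLeast_Suc_atMost[OF assms, of g] by (simp add: numeral_2_eq_2)

text \<open>
  Eliminating \<^term>\<open>S 1\<close> through the zero-sum constraint, this is the
  Cauchy-Schwarz inequality over the other indices with weights
  \<^term>\<open>a i / (t - a i)\<close>, whose total is \<^term>\<open>a 1 / (a 1 - t)\<close>.
\<close>

lemma sum_squares_le_of_root:
  fixes a S :: "nat \<Rightarrow> real"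
  assumes "k \<ge> 1" and root: "(\<Sum>i=1..k. a i / (a i - t)) = 0"
    and a1: "0 < a 1" "t < a 1" and ai: "\<And>i. i \<in> {2..k} \<Longrightarrow> 0 < a i \<and> a i < t"
    and S: "(\<Sum>i=1..k. S i) = 0"
  shows "(\<Sum>i=1..k. (S i)\<^sup>2) \<le> t * (\<Sum>i=1..k. (S i)\<^sup>2 / a i)"
proof -
  define w where "w i = a i / (t - a i)" for i
  have w: "w i > 0" if "i \<in> {2..k}" for i using ai[OF that] by (simp add: w_def)
  have wsum: "(\<Sum>i=2..k. w i) = a 1 / (a 1 - t)"
  proof -
    have "a i / (a i - t) = - w i" for i
      unfolding w_def by (metis minus_diff_eq minus_divide_right)
    then show ?thesis using root sum_atLeast1_split[OF assms(1), of "\<lambda>i. a i / (a i - t)"]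
      by (simp add: sum_negf)
  qed
  have "(S 1)\<^sup>2 = (\<Sum>i=2..k. sqrt (w i) * (S i / sqrt (w i)))\<^sup>2"
  proof -
    have "(\<Sum>i=2..k. sqrt (w i) * (S i / sqrt (w i))) = (\<Sum>i=2..k. S i)"
      using w by (intro sum.cong) fastforce+
    also have "\<dots> = - S 1" using S sum_atLeast1_split[OF assms(1), of S] by simp
    finally show ?thesis by simp
  qed
  also have "\<dots> \<le> (\<Sum>i=2..k. (sqrt (w i))\<^sup>2) * (\<Sum>i=2..k. (S i / sqrt (w i))\<^sup>2)"
    by (rule Cauchy_Schwarz_ineq_sum)
  also have "(\<Sum>i=2..k. (sqrt (w i))\<^sup>2) = a 1 / (a 1 - t)"
    unfolding wsum[symmetric] using w by (intro sum.cong) fastforce+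
  also have "(\<Sum>i=2..k. (S i / sqrt (w i))\<^sup>2) = (\<Sum>i=2..k. t * ((S i)\<^sup>2 / a i) - (S i)\<^sup>2)"
  proof (intro sum.cong refl)
    fix i assume i: "i \<in> {2..k}"
    have "(S i / sqrt (w i))\<^sup>2 = (S i)\<^sup>2 / w i" using w[OF i] by (simp add: power_divide)
    \<comment> \<open>The weight was chosen so that \<open>1 / w i = t / a i - 1\<close>.\<close>
    also have "\<dots> = t * ((S i)\<^sup>2 / a i) - (S i)\<^sup>2"
      using ai[OF i] by (simp add: w_def field_simps)
    finally show "(S i / sqrt (w i))\<^sup>2 = t * ((S i)\<^sup>2 / a i) - (S i)\<^sup>2" .
  qed
  also have "\<dots> = t * (\<Sum>i=2..k. (S i)\<^sup>2 / a i) - (\<Sum>i=2..k. (S i)\<^sup>2)"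
    by (simp add: sum_subtractf sum_distrib_left)
  finally have "(S 1)\<^sup>2 * (a 1 - t) / a 1 \<le> t * (\<Sum>i=2..k. (S i)\<^sup>2 / a i) - (\<Sum>i=2..k. (S i)\<^sup>2)"
    using a1 by (simp add: field_simps)
  moreover have "(S 1)\<^sup>2 * (a 1 - t) / a 1 = (S 1)\<^sup>2 - t * ((S 1)\<^sup>2 / a 1)"
    using a1 by (simp add: field_simps)
  ultimately show ?thesis
    unfolding sum_atLeast1_split[OF assms(1)] by (simp add: distrib_left)
qed

section \<open>Roots of the characteristic equation when one weight is strictly largest\<close>

locale dominant_part =
  fixes k :: nat and a :: "nat \<Rightarrow> real"
  assumes two_le: "k \<ge> 2"
    and pos: "i \<in> {1..k} \<Longrightarrow> 0 < a i"
    and le_second: "i \<in> {2..k} \<Longrightarrow> a i \<le> a 2"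
    and less: "a 2 < a 1"
begin

text \<open>At a pole the undefined term counts as zero, so a zero of \<open>char_fun\<close> is a
  genuine root only away from the points \<open>- a i\<close>.\<close>

definition char_fun :: "real \<Rightarrow> real" where
  "char_fun \<alpha> = (\<Sum>i=1..k. a i / (\<alpha> + a i))"

lemma char_fun_split: "char_fun \<alpha> = a 1 / (\<alpha> + a 1) + (\<Sum>i=2..k. a i / (\<alpha> + a i))"
  unfolding char_fun_def using two_le by (intro sum_atLeast1_split) simp

lemma denominators:
  assumes "- a 1 < \<alpha>" "\<alpha> < - a 2" "i \<in> {1..k}"
  shows "i = 1 \<and> \<alpha> + a i > 0 \<or> i \<in> {2..k} \<and> \<alpha> + a i < 0"
  using assms le_second[of i] by (cases "i = 1") auto

text \<open>Each term decreases on an interval free of its pole: both denominators of a term have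
  the same sign.\<close>

lemma char_fun_strict_antimono:
  assumes "- a 1 < \<alpha>" "\<alpha> < \<beta>" "\<beta> < - a 2"
  shows "char_fun \<beta> < char_fun \<alpha>"
  unfolding char_fun_def
proof (rule sum_strict_mono)
  fix i assume i: "i \<in> {1..k}"
  have "(\<alpha> + a i) * (\<beta> + a i) > 0"
    using denominators[OF _ _ i, of \<alpha>] denominators[OF _ _ i, of \<beta>] assms
    by (auto intro: mult_pos_pos mult_neg_neg)
  moreover have "\<alpha> + a i < \<beta> + a i" using assms by simp
  ultimately show "a i / (\<beta> + a i) < a i / (\<alpha> + a i)"
    using pos[OF i] by (intro divide_strict_left_mono) (auto simp: mult.commute)
qed (use two_le in auto)

text \<open>As \<open>a 1\<close> is the largest weight, every denominator is negative here.\<close>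

lemma char_fun_neg:
  assumes "\<alpha> < - a 1"
  shows "char_fun \<alpha> < 0"
proof -
  have "char_fun \<alpha> < (\<Sum>i=1..k. 0)"
    unfolding char_fun_def
  proof (rule sum_strict_mono)
    fix i assume i: "i \<in> {1..k}"
    then have "a i \<le> a 1" using le_second[of i] less by (cases "i = 1") auto
    then show "a i / (\<alpha> + a i) < 0" using assms pos[OF i] by (simp add: divide_pos_neg)
  qed (use two_le in auto)
  then show ?thesis by simp
qed

text \<open>
  The endpoints come from replacing the sum over the remaining parts by \<^term>\<open>k - 1\<close> copies
  (a lower bound for the function) or by a single copy (an upper bound) of the second term.
\<close>

lemma char_fun_root_exists:
  obtains \<alpha> where "- a 1 < \<alpha>" "\<alpha> < - a 2" "char_fun \<alpha> = 0"
proof -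
  \<comment> \<open>With \<open>\<alpha> = d n - a 1\<close>, this solves
    \<open>a 1 / (\<alpha> + a 1) + n * (a 2 / (\<alpha> + a 2)) = 0\<close>, the equation for one
    part of size \<open>a 1\<close> and \<open>n\<close> parts of size \<open>a 2\<close>.\<close>
  define d where "d n = a 1 * (a 1 - a 2) / (a 1 + n * a 2)" for n :: real
  have a: "a 1 > 0" "a 2 > 0" using pos two_le by auto
  have den: "a 1 + n * a 2 > 0" if "n \<ge> 1" for n
    using a that by (simp add: add_pos_nonneg)
  have d_pos: "d n > 0" if "n \<ge> 1" for n
    using a less den[OF that] by (simp add: d_def)
  \<comment> \<open>The distance from \<open>d n - a 1\<close> to the right endpoint
    \<open>- a 2\<close>, in a form whose sign is visible.\<close>
  have gap: "a 1 - d n - a 2 = n * a 2 * d n / a 1" if "n \<ge> 1" for n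
  proof -
    have "d n * (a 1 + n * a 2) = a 1 * (a 1 - a 2)"
      using den[OF that] by (simp add: d_def)
    then have "(a 1 - d n - a 2) * a 1 = n * a 2 * d n" by (simp add: algebra_simps)
    then show ?thesis using a by (simp add: eq_divide_eq)
  qed
  have gap_pos: "a 1 - d n - a 2 > 0" if "n \<ge> 1" for n
    unfolding gap[OF that] using a that d_pos[OF that] by simp
  have term2: "n * (a 2 / (d n - a 1 + a 2)) = - (a 1 / d n)" if "n \<ge> 1" for n
  proof -
    have "d n - a 1 + a 2 = - (n * a 2 * d n / a 1)" using gap[OF that] by linarith
    then have "n * (a 2 / (d n - a 1 + a 2)) = n * (a 2 / - (n * a 2 * d n / a 1))" by (rule arg_cong)
    also have "\<dots> = - (a 1 / d n)" using a that d_pos[OF that] by simp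
    finally show ?thesis .
  qed
  define n where "n = real (k - 1)"
  have n: "n \<ge> 1" using two_le by (simp add: n_def)
  have range: "- a 1 < d n - a 1" "d n - a 1 < - a 2" if "n \<ge> 1" for n
    using d_pos[OF that] gap_pos[OF that] by auto
  have "(\<Sum>i=2..k. x) = n * x" for x :: real by (simp add: n_def)
  then have "n * (a 2 / (d n - a 1 + a 2)) = (\<Sum>i=2..k. a 2 / (d n - a 1 + a 2))"
    by (rule sym)
  \<comment> \<open>For fixed \<open>\<beta> < 0\<close> the map sending \<open>x\<close> to
    \<open>x / (\<beta> + x)\<close> decreases where \<open>\<beta> + x < 0\<close>, so replacing
    \<open>a i\<close> by the larger \<open>a 2\<close> lowers the term.\<close>
  also have "\<dots> \<le> (\<Sum>i=2..k. a i / (d n - a 1 + a i))"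
  proof (rule sum_mono)
    fix i assume i: "i \<in> {2..k}"
    have "d n - a 1 + a 2 < 0" "d n - a 1 + a i < 0" "d n - a 1 < 0"
      using range[OF n] le_second[OF i] a by auto
    moreover have "(d n - a 1) * a 2 \<le> (d n - a 1) * a i"
      using \<open>d n - a 1 < 0\<close> le_second[OF i] by simp
    ultimately have "a 2 * (d n - a 1 + a i) - a i * (d n - a 1 + a 2) \<le> 0"
      "0 < (d n - a 1 + a 2) * (d n - a 1 + a i)"
      by (simp_all only: mult_neg_neg) (simp add: algebra_simps)
    then show "a 2 / (d n - a 1 + a 2) \<le> a i / (d n - a 1 + a i)"
      using \<open>d n - a 1 + a 2 < 0\<close> \<open>d n - a 1 + a i < 0\<close>
      by (subst frac_le_eq) (simp_all only: divide_nonpos_pos less_imp_neq not_False_eq_True)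
  qed
  finally have lower: "char_fun (d n - a 1) \<ge> 0"
    using term2[OF n] by (simp add: char_fun_split)
  have "(\<Sum>i=2..k. a i / (d 1 - a 1 + a i))
      = a 2 / (d 1 - a 1 + a 2) + (\<Sum>i=3..k. a i / (d 1 - a 1 + a i))"
    using sum.atLeast_Suc_atMost[OF two_le, of "\<lambda>i. a i / (d 1 - a 1 + a i)"] by simp
  also have "(\<Sum>i=3..k. a i / (d 1 - a 1 + a i)) \<le> 0"
  proof (rule sum_nonpos)
    fix i assume "i \<in> {3..k}"
    then have "0 < a i" "d 1 - a 1 + a i < 0"
      using pos[of i] denominators[of "d 1 - a 1" i] range[of 1] by auto
    then show "a i / (d 1 - a 1 + a i) \<le> 0" by (simp add: divide_nonneg_neg)
  qed
  finally have upper: "char_fun (d 1 - a 1) \<le> 0"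
    using term2[of 1] by (simp add: char_fun_split)
  \<comment> \<open>The two comparison points are in the right order for the intermediate value
    theorem: \<open>char_fun\<close> is nonnegative at the left one and nonpositive at the right
    one.\<close>
  have "d n \<le> d 1" unfolding d_def
    using a less n by (intro divide_left_mono) (auto intro!: mult_pos_pos add_pos_pos)
  moreover have "continuous_on {d n - a 1..d 1 - a 1} char_fun"
    unfolding char_fun_def
  proof (intro continuous_intros ballI)
    fix i x assume "i \<in> {1..k}" "x \<in> {d n - a 1..d 1 - a 1}"
    then show "x + a i \<noteq> 0"
      using denominators[of x i] range[OF n] range[of 1] by force
  qed
  ultimately obtain x where "d n - a 1 \<le> x" "x \<le> d 1 - a 1" "char_fun x = 0"
    using IVT2'[of char_fun "d 1 - a 1" 0 "d n - a 1"] lower upper by auto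
  then show thesis using that[of x] range[OF n] range[of 1] by auto
qed

text \<open>The equality condition of \<open>QEC_eqI\<close> for
  \<open>c i = 1 / (\<alpha> + a i)\<close>. It follows by writing one factor \<open>a i\<close> of
  the square as \<open>(\<alpha> + a i) - \<alpha>\<close>; the first resulting sum is
  \<open>char_fun \<alpha>\<close>.\<close>

lemma char_fun_root_weighted_squares:
  assumes "- a 1 < \<alpha>" "\<alpha> < - a 2" "char_fun \<alpha> = 0"
  shows "(\<Sum>i=1..k. (a i * (1 / (\<alpha> + a i)))\<^sup>2) = - \<alpha> * (\<Sum>i=1..k. a i * (1 / (\<alpha> + a i))\<^sup>2)"
proof -
  have "(a i * (1 / (\<alpha> + a i)))\<^sup>2 = a i / (\<alpha> + a i) - \<alpha> * (a i * (1 / (\<alpha> + a i))\<^sup>2)"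
    if "i \<in> {1..k}" for i
  proof -
    have "\<alpha> + a i \<noteq> 0" using denominators[OF assms(1,2) that] by auto
    then show ?thesis by (simp add: divide_simps) (simp add: power2_eq_square algebra_simps)
  qed
  then have "(\<Sum>i=1..k. (a i * (1 / (\<alpha> + a i)))\<^sup>2)
      = char_fun \<alpha> - \<alpha> * (\<Sum>i=1..k. a i * (1 / (\<alpha> + a i))\<^sup>2)"
    by (simp add: char_fun_def sum_subtractf sum_distrib_left)
  then show ?thesis using assms by simp
qed

end

section \<open>The value of the constant in the two cases\<close>

context multipartite
begin

lemma QEC_equal_parts:
  assumes "m 1 = m 2" and max: "\<And>i. i \<in> {1..k} \<Longrightarrow> m i \<le> m 1"
  shows "QEC G = real (m 1) - 2"
proof (rule QEC_eqI)
  \<comment> \<open>Opposite values on the two largest parts and zero elsewhere, so only parts of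
    size \<open>m 1\<close> contribute.\<close>
  define c :: "nat \<Rightarrow> real" where "c i = of_bool (i = 1) - of_bool (i = 2)" for i
  have m: "m 1 > 0" using part_pos two_le by simp
  have split: "(\<Sum>i=1..k. g i) = g 1 + g 2" if "\<And>i. i \<in> {3..k} \<Longrightarrow> g i = 0" for g :: "nat \<Rightarrow> real"
  proof -
    have "(\<Sum>i=1..k. g i) = (\<Sum>i\<in>{1,2}. g i)"
      using two_le that by (intro sum.mono_neutral_right) auto
    then show ?thesis by simp
  qed
  have c: "c i = 0" if "i \<in> {3..k}" for i using that by (auto simp: c_def)
  show "(\<Sum>i=1..k. m i * c i) = 0"
    using assms(1) c by (subst split) (auto simp: c_def)
  have sq: "(\<Sum>i=1..k. m i * (c i)\<^sup>2) = 2 * m 1"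
    using assms(1) c by (subst split) (auto simp: c_def)
  then show "(\<Sum>i=1..k. m i * (c i)\<^sup>2) > 0" using m by simp
  have "(\<Sum>i=1..k. (m i * c i)\<^sup>2) = m 1 * (2 * m 1)"
    using assms(1) c by (subst split) (auto simp: c_def power2_eq_square)
  then show "(\<Sum>i=1..k. (m i * c i)\<^sup>2) = m 1 * (\<Sum>i=1..k. m i * (c i)\<^sup>2)"
    unfolding sq by simp
  fix S :: "nat \<Rightarrow> real"
  show "(\<Sum>i=1..k. (S i)\<^sup>2) \<le> m 1 * (\<Sum>i=1..k. (S i)\<^sup>2 / m i)"
    unfolding sum_distrib_left
  proof (rule sum_mono)
    fix i assume i: "i \<in> {1..k}"
    have "(S i)\<^sup>2 * m i \<le> (S i)\<^sup>2 * m 1" using max[OF i] by (intro mult_left_mono) auto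
    then show "(S i)\<^sup>2 \<le> m 1 * ((S i)\<^sup>2 / m i)"
      using part_pos[OF i] by (simp add: field_simps)
  qed
qed simp

lemma QEC_dominant_part:
  assumes "dominant_part k (\<lambda>i. real (m i))"
    and \<alpha>: "- real (m 1) < \<alpha>" "\<alpha> < - real (m 2)" "dominant_part.char_fun k (\<lambda>i. real (m i)) \<alpha> = 0"
  shows "QEC G = - \<alpha> - 2"
proof (rule QEC_eqI)
  interpret D: dominant_part k "\<lambda>i. real (m i)" by fact
  show "- \<alpha> \<ge> 0" using \<alpha> by simp
  have sum0: "(\<Sum>i=1..k. m i / (\<alpha> + m i)) = 0" using \<alpha> by (simp add: D.char_fun_def)
  \<comment> \<open>The choice \<open>c i = 1 / (\<alpha> + m i)\<close> makes
    \<open>m i * c i + \<alpha> * c i\<close> the same for all \<open>i\<close>, which is the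
    Lagrange condition for the constrained maximum; the root equation then says that the total is
    zero.\<close>
  then show "(\<Sum>i=1..k. m i * (1 / (\<alpha> + m i))) = 0" by simp
  show "(\<Sum>i=1..k. (m i * (1 / (\<alpha> + m i)))\<^sup>2) = - \<alpha> * (\<Sum>i=1..k. m i * (1 / (\<alpha> + m i))\<^sup>2)"
    by (rule D.char_fun_root_weighted_squares[OF \<alpha>])
  show "(\<Sum>i=1..k. m i * (1 / (\<alpha> + m i))\<^sup>2) > 0"
  proof (rule sum_pos)
    fix i assume i: "i \<in> {1..k}"
    then show "m i * (1 / (\<alpha> + m i))\<^sup>2 > 0"
      using D.denominators[OF \<alpha>(1,2) i] D.pos[OF i] by auto
  qed (use two_le in auto)
  fix S :: "nat \<Rightarrow> real"
  assume "(\<Sum>i=1..k. S i) = 0"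
  moreover have "0 < real (m i) \<and> real (m i) < - \<alpha>" if "i \<in> {2..k}" for i
    using that D.pos[of i] D.le_second[OF that] \<alpha> by auto
  ultimately show "(\<Sum>i=1..k. (S i)\<^sup>2) \<le> - \<alpha> * (\<Sum>i=1..k. (S i)\<^sup>2 / m i)"
    using sum0 D.pos[of 1] \<alpha> two_le
    by (intro sum_squares_le_of_root) (auto simp: add.commute)
qed

end

theorem theorem1p1:
  fixes G :: "('a, 'b) pre_digraph" and k :: nat and m :: "nat \<Rightarrow> nat"
  assumes "k \<ge> 2"
    and "\<And>i j. 1 \<le> i \<Longrightarrow> i \<le> j \<Longrightarrow> j \<le> k \<Longrightarrow> m j \<le> m i"
    and "m k \<ge> 1"
    and "complete_multipartite k m G"
  shows "(m 1 = m 2 \<longrightarrow> QEC G = - 2 + real (m 1)) \<and>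
    (m 1 > m 2 \<longrightarrow>
      (\<exists>\<alpha>s. char_root k m \<alpha>s \<and> (\<forall>\<alpha>. char_root k m \<alpha> \<longrightarrow> \<alpha>s \<le> \<alpha>) \<and>
            QEC G = - 2 - \<alpha>s \<and> - real (m 1) < \<alpha>s \<and> \<alpha>s < - real (m 2)))"
proof (intro conjI impI)
  have pos: "m i > 0" if "i \<in> {1..k}" for i
    using assms(2)[of i k] assms(3) that by auto
  obtain V where V: "multipartite G k m V"
    using assms(1,4) pos unfolding complete_multipartite_def multipartite_def by fastforce
  interpret multipartite G k m V by (fact V)
  show "QEC G = - 2 + real (m 1)" if "m 1 = m 2"
    using QEC_equal_parts[OF that] assms(2) by simp
  assume less: "m 1 > m 2"
  have D: "dominant_part k (\<lambda>i. real (m i))"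
    using assms(1,2) pos less by unfold_locales auto
  interpret D: dominant_part k "\<lambda>i. real (m i)" by (fact D)
  obtain \<alpha>s where \<alpha>s: "- real (m 1) < \<alpha>s" "\<alpha>s < - real (m 2)" "D.char_fun \<alpha>s = 0"
    by (rule D.char_fun_root_exists)
  have "char_root k m \<alpha>s"
    using \<alpha>s D.denominators[OF \<alpha>s(1,2)] by (force simp: char_root_def D.char_fun_def)
  moreover have "\<alpha>s \<le> \<alpha>" if root: "char_root k m \<alpha>" for \<alpha>
  proof (rule ccontr)
    assume "\<not> \<alpha>s \<le> \<alpha>"
    \<comment> \<open>A smaller root avoids the pole \<open>- m 1\<close>. To its left
      \<open>char_fun\<close> is negative; between it and \<open>\<alpha>s\<close> strict decrease
      makes \<open>char_fun\<close> positive.\<close>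
    have "\<alpha> \<noteq> - real (m 1)" "D.char_fun \<alpha> = 0"
      using root assms(1) by (force simp: char_root_def D.char_fun_def)+
    then show False
      using \<open>\<not> \<alpha>s \<le> \<alpha>\<close> \<alpha>s D.char_fun_neg[of \<alpha>] D.char_fun_strict_antimono[of \<alpha> \<alpha>s]
      by (cases "\<alpha> < - real (m 1)") auto
  qed
  ultimately show "\<exists>\<alpha>s. char_root k m \<alpha>s \<and> (\<forall>\<alpha>. char_root k m \<alpha> \<longrightarrow> \<alpha>s \<le> \<alpha>) \<and>
      QEC G = - 2 - \<alpha>s \<and> - real (m 1) < \<alpha>s \<and> \<alpha>s < - real (m 2)"
    using \<alpha>s QEC_dominant_part[OF D \<alpha>s] by (intro exI[of _ \<alpha>s]) auto
qed

end
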